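(* Let $B$ be a complex unital primitive Banach algebra with nonzero socle. If derivations $d,g:B\to B$ satisfy $\sigma(g(x))\subseteq \sigma(d(x))\cup\{0\}$ for all $x\in \mathrm{soc}(B)$, then $g=\lambda d$ for some $\lambda\in\{-1,0,1\}$.
   Context: All Banach algebras are complex and have an identity element. $\sigma(x)$ denotes the spectrum of $x$ in $B$. A derivation of $B$ is a linear map $d:B\to B$ with $d(xy)=d(x)y+xd(y)$ for all $x,y\in B$ (continuity is not assumed). A semiprime Banach algebra $B$ (in particular a primitive one) is said to have a nonzero socle if it has minimal one-sided ideals; in this case the socle $\mathrm{soc}(B)$ is the sum of all minimal left ideals of $B$ (equivalently, the sum of all minimal right ideals of $B$). *)

theory Defs
  imports "HOL-Analysis.Analysis"
begin

class complex_vector = ab_group_add +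
  fixes scaleC :: "complex \<Rightarrow> 'a \<Rightarrow> 'a"  (infixr "*\<^sub>C" 75)
  assumes scaleC_add_right: "c *\<^sub>C (x + y) = c *\<^sub>C x + c *\<^sub>C y"
    and scaleC_add_left: "(b + c) *\<^sub>C x = b *\<^sub>C x + c *\<^sub>C x"
    and scaleC_scaleC: "b *\<^sub>C c *\<^sub>C x = (b * c) *\<^sub>C x"
    and scaleC_one: "1 *\<^sub>C x = x"

global_interpretation complex_vector:
    vector_space "scaleC :: complex \<Rightarrow> 'a \<Rightarrow> 'a::complex_vector"
  by unfold_locales (fact scaleC_add_right scaleC_add_left scaleC_scaleC scaleC_one)+

(* Complex Banach algebras with an identity element. The norm is submultiplicative;
   norm 1 = 1 is not required, so both common conventions are covered. *)
class complex_banach_algebra_1 =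
    complex_vector + real_normed_algebra + real_algebra_1 + banach +
  assumes scaleR_scaleC: "r *\<^sub>R x = complex_of_real r *\<^sub>C x"
    and mult_scaleC_left: "(c *\<^sub>C x) * y = c *\<^sub>C (x * y)"
    and mult_scaleC_right: "x * (c *\<^sub>C y) = c *\<^sub>C (x * y)"
    and norm_scaleC: "norm (c *\<^sub>C x) = cmod c * norm x"

definition invertible_elem :: "'a::ring_1 \<Rightarrow> bool" where
  "invertible_elem a \<longleftrightarrow> (\<exists>b. a * b = 1 \<and> b * a = 1)"

definition spectrum :: "'a::complex_banach_algebra_1 \<Rightarrow> complex set" where
  "spectrum x = {c. \<not> invertible_elem (c *\<^sub>C 1 - x)}"

definition derivation :: "('a::complex_banach_algebra_1 \<Rightarrow> 'a) \<Rightarrow> bool" where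
  "derivation d \<longleftrightarrow> Vector_Spaces.linear scaleC scaleC d \<and> (\<forall>x y. d (x * y) = d x * y + x * d y)"

definition left_ideal :: "'a::complex_banach_algebra_1 set \<Rightarrow> bool" where
  "left_ideal L \<longleftrightarrow> complex_vector.subspace L \<and> (\<forall>a. \<forall>x\<in>L. a * x \<in> L)"

definition right_ideal :: "'a::complex_banach_algebra_1 set \<Rightarrow> bool" where
  "right_ideal R \<longleftrightarrow> complex_vector.subspace R \<and> (\<forall>a. \<forall>x\<in>R. x * a \<in> R)"

definition maximal_left_ideal :: "'a::complex_banach_algebra_1 set \<Rightarrow> bool" where
  "maximal_left_ideal L \<longleftrightarrow>
     left_ideal L \<and> L \<noteq> UNIV \<and> (\<forall>J. left_ideal J \<and> L \<subseteq> J \<longrightarrow> J = L \<or> J = UNIV)"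

definition minimal_left_ideal :: "'a::complex_banach_algebra_1 set \<Rightarrow> bool" where
  "minimal_left_ideal L \<longleftrightarrow>
     left_ideal L \<and> L \<noteq> {0} \<and> (\<forall>J. left_ideal J \<and> J \<subseteq> L \<longrightarrow> J = {0} \<or> J = L)"

definition minimal_right_ideal :: "'a::complex_banach_algebra_1 set \<Rightarrow> bool" where
  "minimal_right_ideal R \<longleftrightarrow>
     right_ideal R \<and> R \<noteq> {0} \<and> (\<forall>J. right_ideal J \<and> J \<subseteq> R \<longrightarrow> J = {0} \<or> J = R)"

(* The quotient (L : B) of a maximal left ideal L, that is, the kernel of the irreducible
   left module B / L. Since B has an identity, every left ideal is modular. *)
definition primitive_ideal :: "'a::complex_banach_algebra_1 set \<Rightarrow> bool" where
  "primitive_ideal P \<longleftrightarrow> (\<exists>L. maximal_left_ideal L \<and> P = {a. \<forall>b. a * b \<in> L})"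

definition primitive_algebra :: "'a::complex_banach_algebra_1 itself \<Rightarrow> bool" where
  "primitive_algebra _ \<longleftrightarrow> primitive_ideal ({0} :: 'a set)"

definition has_nonzero_socle :: "'a::complex_banach_algebra_1 itself \<Rightarrow> bool" where
  "has_nonzero_socle _ \<longleftrightarrow>
     (\<exists>L :: 'a set. minimal_left_ideal L) \<or> (\<exists>R :: 'a set. minimal_right_ideal R)"

(* A sum of subspaces is the span of their union. *)
definition socle :: "'a::complex_banach_algebra_1 set" where
  "socle = complex_vector.span (\<Union>{L. minimal_left_ideal L})"

end

theory Submission
  imports Defs "HOL-Computational_Algebra.Polynomial"
begin

text \<open>
  By Gelfand--Mazur there is an idempotent \<open>e\<close> with \<open>e w e = \<tau>(w) e\<close> for all \<open>w\<close>, and primeness makes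
  \<open>Be\<close> a faithful module. For \<open>u \<in> Be\<close> and \<open>v \<in> eB\<close> with \<open>v u = 0\<close> the square-zero element
  \<open>u v\<close> lies in the socle, \<open>d(u v)\<close> is annihilated by \<open>z(z\<^sup>2 - s\<^sup>2)\<close> where \<open>v d(u) = s e\<close>, and \<open>- s\<close> is
  an eigenvalue with eigenvector \<open>u\<close>. So the spectral inclusion says that the product of
  \<open>v h(u)\<close> over \<open>h = g, g - d, g + d\<close> vanishes whenever \<open>v u = 0\<close>. Parametrising such \<open>v\<close> turns this
  into a product of three functions that are polynomial on lines, hence for one of the three
  derivations \<open>h\<close> every \<open>u \<in> Be\<close> is an eigenvector of \<open>x \<mapsto> h(x)e\<close>. Since \<open>e h(e) e = 0\<close>,
  the eigenvalues are all zero, and then \<open>h = 0\<close>.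
\<close>

section \<open>Gelfand--Mazur\<close>

lemma bounded_bilinear_scaleC:
  "bounded_bilinear (scaleC :: complex \<Rightarrow> 'a::complex_banach_algebra_1 \<Rightarrow> 'a)"
proof
  fix r :: real and c :: complex and x :: 'a
  show "(r *\<^sub>R c) *\<^sub>C x = r *\<^sub>R c *\<^sub>C x" "c *\<^sub>C r *\<^sub>R x = r *\<^sub>R c *\<^sub>C x"
    by (simp_all add: scaleR_scaleC scaleC_scaleC scaleR_conv_of_real mult.commute)
  show "\<exists>K. \<forall>a b. norm (a *\<^sub>C (b::'a)) \<le> norm a * norm b * K"
    by (rule exI[of _ 1]) (simp add: norm_scaleC)
qed (simp_all add: scaleC_add_left scaleC_add_right)

text \<open>Describes an \<open>x\<close> with empty spectrum relative to the unit \<open>e\<close>;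
  the goal is \<open>e = 0\<close>. Keeping \<open>e\<close> apart from \<open>1\<close> lets the
  argument run in a corner \<open>e B e\<close> without a type of its own.\<close>

locale resolvent =
  fixes e x :: "'a::complex_banach_algebra_1" and R :: "complex \<Rightarrow> 'a"
  assumes left_inverse: "R z * (x - z *\<^sub>C e) = e"
    and right_inverse: "(x - z *\<^sub>C e) * R z = e"
    and left_unit: "e * R z = R z"
    and right_unit: "R z * e = R z"
begin

lemma resolvent_identity: "R z - R w = (z - w) *\<^sub>C (R z * R w)"
proof -
  have "R z - R w = R z * ((x - w *\<^sub>C e) * R w) - R z * (x - z *\<^sub>C e) * R w"
    by (simp add: left_inverse right_inverse left_unit right_unit)
  also have "\<dots> = R z * (z *\<^sub>C e - w *\<^sub>C e) * R w"
    by (simp add: algebra_simps)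
  also have "\<dots> = (z - w) *\<^sub>C (R z * R w)"
    by (simp add: complex_vector.scale_left_diff_distrib[symmetric] mult_scaleC_left
        mult_scaleC_right right_unit)
  finally show ?thesis .
qed

text \<open>The resolvent identity gives
  \<open>norm (R z) \<le> norm (R w) + norm (R z) / 2\<close>; absorbing the last term bounds
  \<open>norm (R z)\<close> by \<open>2 * norm (R w)\<close>, which is fed back into the
  identity.\<close>

lemma local_bound:
  assumes "cmod (z - w) * norm (R w) \<le> 1 / 2"
  shows "norm (R z - R w) \<le> cmod (z - w) * (2 * norm (R w) * norm (R w))"
proof -
  have 1: "norm (R z - R w) \<le> cmod (z - w) * (norm (R z) * norm (R w))"
    unfolding resolvent_identity norm_scaleC
    by (intro mult_left_mono norm_mult_ineq) simp
  have "norm (R z) \<le> norm (R w) + norm (R z - R w)"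
    using norm_triangle_ineq[of "R w" "R z - R w"] by simp
  also have "\<dots> \<le> norm (R w) + (cmod (z - w) * norm (R w)) * norm (R z)"
    using 1 by (simp add: mult_ac)
  also have "\<dots> \<le> norm (R w) + 1 / 2 * norm (R z)"
    using assms by (intro add_left_mono mult_right_mono) auto
  finally have "norm (R z) \<le> 2 * norm (R w)" by simp
  then have "cmod (z - w) * (norm (R z) * norm (R w)) \<le> cmod (z - w) * (2 * norm (R w) * norm (R w))"
    by (intro mult_left_mono mult_right_mono) auto
  with 1 show ?thesis by linarith
qed

lemma isCont_resolvent: "isCont R w"
proof -
  have "((\<lambda>z. cmod (z - w) * norm (R w)) \<longlongrightarrow> cmod (w - w) * norm (R w)) (at w)"
    by (intro tendsto_intros)
  then have "\<forall>\<^sub>F z in at w. cmod (z - w) * norm (R w) < 1 / 2"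
    by (rule order_tendstoD) simp
  then have ev: "\<forall>\<^sub>F z in at w. norm (R z - R w) \<le> cmod (z - w) * (2 * norm (R w) * norm (R w))"
    by eventually_elim (simp add: local_bound)
  have "((\<lambda>z. cmod (z - w) * (2 * norm (R w) * norm (R w))) \<longlongrightarrow>
      cmod (w - w) * (2 * norm (R w) * norm (R w))) (at w)"
    by (intro tendsto_intros)
  then have "((\<lambda>z. cmod (z - w) * (2 * norm (R w) * norm (R w))) \<longlongrightarrow> 0) (at w)"
    by simp
  from Lim_null_comparison[OF ev this] have "((\<lambda>z. R z - R w) \<longlongrightarrow> 0) (at w)" .
  then show ?thesis
    unfolding isCont_def using LIM_zero_iff by blast
qed

lemma continuous_on_resolvent: "continuous_on S R"
  using isCont_resolvent continuous_at_imp_continuous_on by blast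

lemma has_derivative_resolvent: "(R has_derivative (\<lambda>h. h *\<^sub>C (R w * R w))) (at w)"
  unfolding has_derivative_iff_norm
proof
  show "bounded_linear (\<lambda>h. h *\<^sub>C (R w * R w))"
    by (rule bounded_bilinear.bounded_linear_left[OF bounded_bilinear_scaleC])
  have le: "norm (R z - R w - (z - w) *\<^sub>C (R w * R w)) / norm (z - w)
      \<le> norm (R z - R w) * norm (R w)" if "z \<noteq> w" for z
  proof -
    have "R z - R w - (z - w) *\<^sub>C (R w * R w) = (z - w) *\<^sub>C ((R z - R w) * R w)"
      by (subst resolvent_identity)
        (simp add: left_diff_distrib complex_vector.scale_right_diff_distrib)
    then show ?thesis
      using that norm_mult_ineq[of "R z - R w" "R w"] by (simp add: norm_scaleC)
  qed
  have "((\<lambda>z. norm (R z - R w) * norm (R w)) \<longlongrightarrow> norm (R w - R w) * norm (R w)) (at w)"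
    using isCont_resolvent[of w] unfolding isCont_def by (intro tendsto_intros)
  then have lim: "((\<lambda>z. norm (R z - R w) * norm (R w)) \<longlongrightarrow> 0) (at w)" by simp
  show "((\<lambda>y. norm (R y - R w - (y - w) *\<^sub>C (R w * R w)) / norm (y - w)) \<longlongrightarrow> 0) (at w)"
    by (rule Lim_null_comparison[OF _ lim])
      (use le in \<open>auto simp: eventually_at_filter simp del: norm_minus_commute\<close>)
qed

lemma decay:
  assumes "cmod z > norm x"
  shows "norm (R z) \<le> norm e / (cmod z - norm x)"
proof -
  have "z *\<^sub>C R z = R z * x - e"
    using left_inverse[of z] by (simp add: algebra_simps mult_scaleC_right right_unit)
  then have "cmod z * norm (R z) \<le> norm (R z * x) + norm e"
    by (metis norm_scaleC norm_triangle_ineq4)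
  also have "\<dots> \<le> norm (R z) * norm x + norm e"
    by (simp add: norm_mult_ineq)
  finally show ?thesis
    using assms by (simp add: field_simps)
qed

(* The radial derivative of the mean vanishes because it is, up to the factor i r, the integral
   of the angular derivative around the circle. *)
lemma circle_mean_constant:
  fixes r :: real
  assumes "r \<ge> 0"
  shows "integral {0..2 * pi} (\<lambda>t. R (of_real r * cis t)) = (2 * pi) *\<^sub>R R 0"
proof -
  let ?D = "\<lambda>r t. cis t *\<^sub>C (R (of_real r * cis t) * R (of_real r * cis t))"
  have D_r: "((\<lambda>r. R (of_real r * cis t)) has_vector_derivative ?D r t) (at r within U)" for r t U
  proof -
    have "((\<lambda>r. of_real r * cis t) has_vector_derivative cis t) (at r within U)"
      by (auto intro!: derivative_eq_intros simp: has_vector_derivative_def scaleR_conv_of_real)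
    from vector_derivative_diff_chain_within[OF this
        has_derivative_at_withinI[OF has_derivative_resolvent]]
    show ?thesis by (simp add: o_def)
  qed
  have D_t: "((\<lambda>t. R (of_real r * cis t)) has_vector_derivative (of_real r * \<i>) *\<^sub>C ?D r t) (at t within U)" for r t U
  proof -
    have "((\<lambda>t. of_real r * cis t) has_vector_derivative of_real r * (\<i> * cis t)) (at t within U)"
      unfolding has_vector_derivative_def
      by (auto intro!: derivative_eq_intros simp: scaleR_conv_of_real)
    from vector_derivative_diff_chain_within[OF this
        has_derivative_at_withinI[OF has_derivative_resolvent]]
    show ?thesis by (simp add: o_def scaleC_scaleC mult_ac)
  qed
  have contD: "continuous_on U (\<lambda>(r, t). ?D r t)" for U :: "(real \<times> real) set"
    unfolding split_beta
    by (intro bounded_bilinear.continuous_on[OF bounded_bilinear_scaleC] continuous_intros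
        continuous_on_compose2[OF continuous_on_resolvent[of UNIV]]) auto
  have zero: "integral {0..2 * pi} (?D r) = 0" if "r \<ge> 0" for r
  proof (cases "r = 0")
    \<comment> \<open>At the centre the factor \<open>of_real r * \<i>\<close> is zero and cannot be
      divided out, so a primitive of \<open>cis t\<close> is used directly.\<close>
    case True
    let ?a = "R 0 * R 0"
    have "((\<lambda>t. (- \<i> * cis t) *\<^sub>C ?a) has_vector_derivative cis t *\<^sub>C ?a) (at t within U)" for t U
    proof -
      have "((\<lambda>t. - \<i> * cis t) has_vector_derivative cis t) (at t within U)"
        unfolding has_vector_derivative_def
        by (auto intro!: derivative_eq_intros simp: scaleR_conv_of_real fun_eq_iff complex_eq_iff)
      from bounded_linear.has_vector_derivative[OF
          bounded_bilinear.bounded_linear_left[OF bounded_bilinear_scaleC] this]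
      show ?thesis .
    qed
    then have "((\<lambda>t. cis t *\<^sub>C ?a) has_integral
        (- \<i> * cis (2 * pi)) *\<^sub>C ?a - (- \<i> * cis 0) *\<^sub>C ?a) {0..2 * pi}"
      by (intro fundamental_theorem_of_calculus) auto
    with True show ?thesis
      by (simp add: integral_unique)
  next
    case False
    define k where "k = of_real r * \<i>"
    have k: "k \<noteq> 0"
      using False by (simp add: k_def)
    have "((\<lambda>t. k *\<^sub>C ?D r t) has_integral
        R (of_real r * cis (2 * pi)) - R (of_real r * cis 0)) {0..2 * pi}"
      by (rule fundamental_theorem_of_calculus) (simp, unfold k_def, rule D_t)
    then have "((\<lambda>t. k *\<^sub>C ?D r t) has_integral 0) {0..2 * pi}"
      by simp
    from has_integral_linear[OF this bounded_bilinear.bounded_linear_right[OF bounded_bilinear_scaleC, of "inverse k"]]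
    have "(?D r has_integral 0) {0..2 * pi}"
      using k by (simp add: o_def scaleC_scaleC mult.assoc[symmetric])
    then show ?thesis by (rule integral_unique)
  qed
  have "((\<lambda>r. integral (cbox 0 (2 * pi)) (\<lambda>t. R (of_real r * cis t))) has_vector_derivative
      integral (cbox 0 (2 * pi)) (?D r)) (at r within {0..})" if "r \<ge> 0" for r
  proof (rule leibniz_rule_vector_derivative)
    show "(\<lambda>t. R (of_real r * cis t)) integrable_on cbox 0 (2 * pi)" for r
      by (intro integrable_continuous continuous_on_compose2[OF continuous_on_resolvent[of UNIV]] continuous_intros) auto
  qed (use that D_r contD in auto)
  then have "((\<lambda>r. integral {0..2 * pi} (\<lambda>t. R (of_real r * cis t))) has_derivative (\<lambda>_. 0))
      (at r within {0..})" if "r \<ge> 0" for r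
    using that zero by (auto simp: has_vector_derivative_def)
  then have "\<exists>c. \<forall>r\<in>{0..}. integral {0..2 * pi} (\<lambda>t. R (of_real r * cis t)) = c"
    by (intro has_derivative_zero_constant) simp_all
  then obtain c where c: "\<And>r. r \<ge> 0 \<Longrightarrow> integral {0..2 * pi} (\<lambda>t. R (of_real r * cis t)) = c"
    by auto
  show ?thesis
    using c[of 0] c[of r] assms by simp
qed

text \<open>\<open>R 0\<close> is the mean of \<open>R\<close> over every circle about the origin,
  and by \<open>decay\<close> these means tend to zero with growing radius. Then
  \<open>e = R 0 * x\<close> is zero as well.\<close>

lemma unit_eq_0: "e = 0"
proof -
  have "norm (R 0) \<le> \<epsilon>" if "\<epsilon> > 0" for \<epsilon>
  proof -
    \<comment> \<open>Large enough that \<open>norm e / (r - norm x) \<le> \<epsilon>\<close>; the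
      summand \<open>1\<close> keeps \<open>r\<close> strictly above \<open>norm x\<close>.\<close>
    define r where "r = norm x + norm e / \<epsilon> + 1"
    have r: "r > norm x" "r \<ge> 0" "norm e \<le> \<epsilon> * (r - norm x)"
      using that by (simp_all add: r_def field_simps add_pos_nonneg)
    have bound: "norm (R (of_real r * cis t)) \<le> \<epsilon>" for t
    proof -
      have "norm (R (of_real r * cis t)) \<le> norm e / (r - norm x)"
        using decay[of "of_real r * cis t"] r by (simp add: norm_mult)
      also have "\<dots> \<le> \<epsilon>"
        using r by (simp add: field_simps)
      finally show ?thesis .
    qed
    have "norm (integral {0..2 * pi} (\<lambda>t. R (of_real r * cis t))) \<le> \<epsilon> * (2 * pi - 0)"
    proof (rule integral_bound)
      show "continuous_on {0..2 * pi} (\<lambda>t. R (of_real r * cis t))"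
        by (rule continuous_on_compose2[OF continuous_on_resolvent[of UNIV]])
          (auto intro!: continuous_intros)
    qed (use bound in auto)
    then show ?thesis
      using circle_mean_constant[OF r(2)] by simp
  qed
  then have "R 0 = 0"
    by (metis field_le_epsilon add_0 norm_le_zero_iff)
  then show ?thesis
    using left_inverse[of 0] by simp
qed

end

text \<open>If \<open>x\<close> is no multiple of \<open>e\<close>, every
  \<open>x - z *\<^sub>C e\<close> is a nonzero corner element, and the inverses from
  \<open>inv\<close> form an everywhere defined resolvent.\<close>

theorem gelfand_mazur_corner:
  fixes e x :: "'a::complex_banach_algebra_1"
  assumes "e \<noteq> 0" "e * e = e" "e * x * e = x"
    and inv: "\<And>w. e * w * e = w \<Longrightarrow> w \<noteq> 0 \<Longrightarrow> \<exists>v. e * v * e = v \<and> v * w = e \<and> w * v = e"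
  shows "\<exists>c. x = c *\<^sub>C e"
proof (rule ccontr)
  assume no: "\<not> ?thesis"
  have "\<exists>v. e * v * e = v \<and> v * (x - z *\<^sub>C e) = e \<and> (x - z *\<^sub>C e) * v = e" for z
  proof (rule inv)
    show "e * (x - z *\<^sub>C e) * e = x - z *\<^sub>C e"
      using assms(2,3) by (simp add: left_diff_distrib right_diff_distrib mult_scaleC_left mult_scaleC_right)
    show "x - z *\<^sub>C e \<noteq> 0"
      using no by auto
  qed
  then obtain R where R: "\<And>z. e * R z * e = R z" "\<And>z. R z * (x - z *\<^sub>C e) = e"
      "\<And>z. (x - z *\<^sub>C e) * R z = e"
    by metis
  have "resolvent e x R"
  proof
    fix z
    show "e * R z = R z" "R z * e = R z"
      by (metis R(1) assms(2) mult.assoc)+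
  qed (simp_all add: R)
  then show False
    using resolvent.unit_eq_0 assms(1) by blast
qed

section \<open>Minimal idempotents\<close>

(* The multiplication m is abstract so that the lemma applies to B and to its opposite, that is,
   to minimal left ideals and to minimal right ideals. *)
lemma minimal_ideal_idempotent:
  fixes m :: "'a::complex_banach_algebra_1 \<Rightarrow> 'a \<Rightarrow> 'a"
  assumes assoc: "\<And>x y z. m (m x y) z = m x (m y z)"
    and add_left: "\<And>x y z. m (x + y) z = m x z + m y z"
    and add_right: "\<And>x y z. m x (y + z) = m x y + m x z"
    and scale_left: "\<And>c x y. m (c *\<^sub>C x) y = c *\<^sub>C m x y"
    and prime: "\<And>a b. (\<And>x. m a (m x b) = 0) \<Longrightarrow> a = 0 \<or> b = 0"
    and L: "complex_vector.subspace L" "\<And>a x. x \<in> L \<Longrightarrow> m a x \<in> L" "L \<noteq> {0}"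
    and minimal: "\<And>J. complex_vector.subspace J \<Longrightarrow> (\<And>a x. x \<in> J \<Longrightarrow> m a x \<in> J) \<Longrightarrow> J \<subseteq> L
      \<Longrightarrow> J = {0} \<or> J = L"
  shows "\<exists>e. e \<noteq> 0 \<and> m e e = e \<and>
    (\<forall>w. m e (m w e) = w \<longrightarrow> w \<noteq> 0 \<longrightarrow> (\<exists>v. m e (m v e) = v \<and> m v w = e \<and> m w v = e))"
proof -
  have zero: "m 0 y = 0" "m y 0 = 0" for y
    using add_left[of 0 0 y] add_right[of y 0 0] by simp_all
  have diff: "m (x - y) z = m x z - m y z" for x y z
    using add_left[of "x - y" y z] by (simp add: algebra_simps)
  \<comment> \<open>The image of a left-stable subspace under right multiplication by
    \<open>y\<close> is left-stable and lies in \<open>L\<close>, so minimality decides it. Used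
    with \<open>S = L\<close> and \<open>S = UNIV\<close>.\<close>
  have image: "(\<lambda>z. m z y) ` S = {0} \<or> (\<lambda>z. m z y) ` S = L"
    if "y \<in> L" "complex_vector.subspace S" "\<And>a x. x \<in> S \<Longrightarrow> m a x \<in> S" for y S
  proof (rule minimal)
    show "complex_vector.subspace ((\<lambda>z. m z y) ` S)"
      using that(2) zero(1)[of y] unfolding complex_vector.subspace_def
      by (auto simp: add_left[symmetric] scale_left[symmetric] image_iff)
    show "m a x \<in> (\<lambda>z. m z y) ` S" if "x \<in> (\<lambda>z. m z y) ` S" for a x
      using that \<open>\<And>a x. x \<in> S \<Longrightarrow> m a x \<in> S\<close> by (auto simp: assoc[symmetric])
  qed (use that L(2) in auto)
  \<comment> \<open>If all products within \<open>L\<close> vanished, then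
    \<open>m z (m x z) = 0\<close> for \<open>z \<in> L\<close> and all \<open>x\<close>, and
    primeness would make \<open>L\<close> zero.\<close>
  obtain x y where xy: "x \<in> L" "y \<in> L" "m x y \<noteq> 0"
  proof (rule ccontr)
    assume no: "\<not> thesis"
    have "m x y = 0" if "x \<in> L" "y \<in> L" for x y
      using that no \<open>\<And>x y. x \<in> L \<Longrightarrow> y \<in> L \<Longrightarrow> m x y \<noteq> 0 \<Longrightarrow> thesis\<close> by blast
    then have "z = 0" if "z \<in> L" for z
      using prime[of z z] L(2) that by blast
    then show False
      using L(1,3) complex_vector.subspace_0 by blast
  qed
  have "(\<lambda>z. m z y) ` L = L"
    using image[OF xy(2) L(1,2)] xy by auto
  then obtain e where e: "e \<in> L" "m e y = y"
    using xy(2) by (metis imageE)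
  \<comment> \<open>The annihilator of \<open>y\<close> in \<open>L\<close> omits \<open>x\<close>,
    so it is trivial; it contains \<open>m e e - e\<close> because \<open>m e y = y\<close>.\<close>
  have "{z \<in> L. m z y = 0} = {0} \<or> {z \<in> L. m z y = 0} = L"
    by (rule minimal)
      (use L(1,2) in \<open>auto simp: complex_vector.subspace_def zero add_left scale_left assoc\<close>)
  then have ker: "z = 0" if "z \<in> L" "m z y = 0" for z
    using xy that by blast
  have "m e e - e = 0"
    by (rule ker) (use e L in \<open>simp_all add: complex_vector.subspace_diff diff assoc\<close>)
  then have idem: "m e e = e" by simp
  have nz: "e \<noteq> 0"
    using e(2) xy(3) zero by metis
  have left: "\<exists>v. m e (m v e) = v \<and> m v w = e" if w: "m e (m w e) = w" "w \<noteq> 0" for w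
  proof -
    have "w \<in> L"
      by (metis w(1) L(2) e(1))
    have ew: "m e w = w"
      by (metis w(1) idem assoc)
    have "range (\<lambda>z. m z w) = L"
      using image[OF \<open>w \<in> L\<close> complex_vector.subspace_UNIV] ew w(2) by (metis UNIV_I rangeI singletonD)
    then obtain s where "m s w = e"
      using e(1) by (metis imageE)
    then have "m (m e (m s e)) w = e"
      by (simp add: assoc ew idem)
    moreover have "m e (m (m e (m s e)) e) = m e (m s e)"
      by (simp add: assoc idem) (simp add: assoc[symmetric] idem)
    ultimately show ?thesis by blast
  qed
  \<comment> \<open>The left inverse \<open>v\<close> has a left inverse \<open>y\<close> of its
    own, and \<open>y = y v w = w\<close> makes \<open>v\<close> two-sided.\<close>
  have "\<exists>v. m e (m v e) = v \<and> m v w = e \<and> m w v = e" if w: "m e (m w e) = w" "w \<noteq> 0" for w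
  proof -
    obtain v where v: "m e (m v e) = v" "m v w = e"
      using left[OF w] by blast
    have "v \<noteq> 0"
      using v(2) nz zero by metis
    then obtain y where y: "m e (m y e) = y" "m y v = e"
      using left[OF v(1)] by blast
    have "m y e = y"
      by (metis y(1) idem assoc)
    then have "y = m (m y v) w"
      by (simp add: assoc v(2))
    also have "\<dots> = w"
      by (metis y(2) w(1) idem assoc)
    finally show ?thesis
      using v y(2) by blast
  qed
  with idem nz show ?thesis by blast
qed

text \<open>A nonzero \<open>b\<close> acts nontrivially on the irreducible module
  \<open>B / L\<close>: some \<open>b c\<close> lies outside \<open>L\<close>, so
  \<open>L + B b c = B\<close> by maximality. Multiplying \<open>1 = l + y b c\<close> by
  \<open>a w\<close> puts \<open>a w\<close> into \<open>L\<close>, so \<open>a\<close> annihilates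
  the module.\<close>

lemma primitive_prime:
  fixes a b :: "'a::complex_banach_algebra_1"
  assumes "primitive_algebra TYPE('a)" and zero: "\<And>x. a * x * b = 0"
  shows "a = 0 \<or> b = 0"
proof (rule disjCI)
  assume "b \<noteq> 0"
  obtain L :: "'a set" where "maximal_left_ideal L" and P: "{0} = {a. \<forall>b. a * b \<in> L}"
    using assms(1) unfolding primitive_algebra_def primitive_ideal_def by (elim exE conjE)
  then have L: "left_ideal L" "\<And>J. left_ideal J \<Longrightarrow> L \<subseteq> J \<Longrightarrow> J = L \<or> J = UNIV"
    by (simp_all add: maximal_left_ideal_def)
  have sub: "complex_vector.subspace L" and mult: "\<And>a x. x \<in> L \<Longrightarrow> a * x \<in> L"
    using L(1) by (auto simp: left_ideal_def)
  have "b \<notin> {a. \<forall>b. a * b \<in> L}"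
    using \<open>b \<noteq> 0\<close> P by (metis singletonD)
  then obtain c where c: "b * c \<notin> L" by blast
  define J where "J = {l + y * (b * c) |l y. l \<in> L}"
  have "left_ideal J"
    unfolding left_ideal_def complex_vector.subspace_def
  proof (intro conjI ballI allI)
    show "0 \<in> J"
      unfolding J_def using complex_vector.subspace_0[OF sub] by (auto intro!: exI[of _ 0])
  next
    fix p q assume "p \<in> J" "q \<in> J"
    then obtain l y l' y' where "p = l + y * (b * c)" "q = l' + y' * (b * c)" "l \<in> L" "l' \<in> L"
      unfolding J_def by blast
    then have "p + q = (l + l') + (y + y') * (b * c)" "l + l' \<in> L"
      using complex_vector.subspace_add[OF sub] by (auto simp: algebra_simps)
    then show "p + q \<in> J"
      unfolding J_def by blast
  next
    fix k p assume "p \<in> J"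
    then obtain l y where "p = l + y * (b * c)" "l \<in> L"
      unfolding J_def by blast
    then have "k *\<^sub>C p = k *\<^sub>C l + (k *\<^sub>C y) * (b * c)" "k *\<^sub>C l \<in> L"
      using complex_vector.subspace_scale[OF sub] by (auto simp: scaleC_add_right mult_scaleC_left)
    then show "k *\<^sub>C p \<in> J"
      unfolding J_def by blast
  next
    fix k p assume "p \<in> J"
    then obtain l y where "p = l + y * (b * c)" "l \<in> L"
      unfolding J_def by blast
    then have "k * p = k * l + (k * y) * (b * c)" "k * l \<in> L"
      using mult by (auto simp: algebra_simps)
    then show "k * p \<in> J"
      unfolding J_def by blast
  qed
  moreover have "L \<subseteq> J"
  proof
    fix l assume "l \<in> L"
    then show "l \<in> J"
      unfolding J_def by (intro CollectI exI[of _ l] exI[of _ 0]) simp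
  qed
  moreover have "b * c \<in> J"
    unfolding J_def using complex_vector.subspace_0[OF sub]
    by (intro CollectI exI[of _ 0] exI[of _ 1]) simp
  ultimately have "J = UNIV"
    using L(2) c by (metis)
  then have "1 \<in> J" by simp
  then obtain l y where ly: "1 = l + y * (b * c)" "l \<in> L"
    unfolding J_def by blast
  have "a * w \<in> L" for w
  proof -
    have "a * w = a * w * (l + y * (b * c))"
      by (simp add: ly(1)[symmetric])
    also have "\<dots> = a * w * l + a * (w * y) * b * c"
      by (simp add: algebra_simps)
    also have "\<dots> = a * w * l"
      by (simp only: zero mult_zero_left add_0_right)
    finally show ?thesis
      using mult[OF ly(2), of "a * w"] by simp
  qed
  then have "a \<in> {a. \<forall>b. a * b \<in> L}" by blast
  then show "a = 0"
    unfolding P[symmetric] by simp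
qed

locale minimal_idempotent =
  fixes e :: "'a::complex_banach_algebra_1"
  assumes nonzero: "e \<noteq> 0"
    and idem: "e * e = e"
    and scalar: "\<exists>c. e * w * e = c *\<^sub>C e"
    and prime: "(\<And>x. a * x * b = 0) \<Longrightarrow> a = (0::'a) \<or> b = 0"

lemma minimal_idempotent_exists:
  assumes "primitive_algebra TYPE('a::complex_banach_algebra_1)" "has_nonzero_socle TYPE('a)"
  shows "\<exists>e::'a. minimal_idempotent e"
proof -
  have "\<exists>e::'a. e \<noteq> 0 \<and> e * e = e \<and>
      (\<forall>w. e * w * e = w \<longrightarrow> w \<noteq> 0 \<longrightarrow> (\<exists>v. e * v * e = v \<and> v * w = e \<and> w * v = e))"
    using assms(2) unfolding has_nonzero_socle_def
  proof (elim disjE exE)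
    fix L :: "'a set" assume "minimal_left_ideal L"
    then show ?thesis
      using minimal_ideal_idempotent[of "(*)" L] primitive_prime[OF assms(1)]
      unfolding minimal_left_ideal_def left_ideal_def
      by (simp add: algebra_simps mult_scaleC_left)
  next
    fix L :: "'a set" assume L: "minimal_right_ideal L"
    have "\<exists>e::'a. e \<noteq> 0 \<and> e * e = e \<and>
        (\<forall>w. e * w * e = w \<longrightarrow> w \<noteq> 0 \<longrightarrow> (\<exists>v. e * v * e = v \<and> w * v = e \<and> v * w = e))"
    proof (rule minimal_ideal_idempotent[of "\<lambda>x y. y * x" L])
      fix a b :: 'a assume "\<And>x. b * x * a = 0"
      then show "a = 0 \<or> b = 0"
        using primitive_prime[OF assms(1)] by blast
    qed (use L in \<open>auto simp: minimal_right_ideal_def right_ideal_def distrib_left distrib_right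
        mult.assoc mult_scaleC_right\<close>)
    then show ?thesis by blast
  qed
  then obtain e :: 'a where e: "e \<noteq> 0" "e * e = e"
      "\<And>w. e * w * e = w \<Longrightarrow> w \<noteq> 0 \<Longrightarrow> \<exists>v. e * v * e = v \<and> v * w = e \<and> w * v = e"
    by blast
  have "\<exists>c. e * w * e = c *\<^sub>C e" for w
    by (rule gelfand_mazur_corner[OF e(1,2) _ e(3)]) (metis e(2) mult.assoc)+
  then show ?thesis
    using e primitive_prime[OF assms(1)] by (auto intro!: exI[of _ e] minimal_idempotent.intro)
qed

section \<open>The corner functional and minimal left ideals in the socle\<close>

context minimal_idempotent
begin

text \<open>The coordinate in the one-dimensional corner \<open>e B e\<close>. The choice is
  determined because \<open>e\<close> is nonzero; \<open>\<tau> (v * u)\<close> serves as the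
  pairing of \<open>eB\<close> with \<open>Be\<close>.\<close>

definition \<tau> :: "'a \<Rightarrow> complex" where
  "\<tau> w = (SOME c. e * w * e = c *\<^sub>C e)"

lemma tau: "e * w * e = \<tau> w *\<^sub>C e"
  unfolding \<tau>_def using someI_ex[OF scalar] .

lemma tau_eqI: "e * w * e = c *\<^sub>C e \<Longrightarrow> \<tau> w = c"
  using nonzero tau[of w] complex_vector.scale_right_imp_eq by metis

lemma tau_add: "\<tau> (v + w) = \<tau> v + \<tau> w"
  by (rule tau_eqI) (simp add: algebra_simps tau[unfolded mult.assoc] scaleC_add_left)

lemma tau_scale: "\<tau> (c *\<^sub>C w) = c * \<tau> w"
  by (rule tau_eqI) (simp add: mult_scaleC_left mult_scaleC_right tau scaleC_scaleC)

lemma tau_diff: "\<tau> (v - w) = \<tau> v - \<tau> w"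
  using tau_add[of "v - w" w] by simp

lemma tau_unit [simp]: "\<tau> (e * w) = \<tau> w" "\<tau> (w * e) = \<tau> w"
  by (rule tau_eqI; simp add: tau[symmetric] mult.assoc[symmetric] idem;
      simp add: mult.assoc idem)+

text \<open>The hypothesis says \<open>e x (b e) = 0\<close> for all \<open>x\<close>, so primeness
  makes the pairing nondegenerate on \<open>Be\<close>.\<close>

lemma tau_nondegenerate:
  assumes "\<And>w. \<tau> (w * b) = 0"
  shows "b * e = 0"
proof -
  have "e * x * (b * e) = 0" for x
    using tau[of "x * b"] assms[of x] by (simp add: mult.assoc)
  then show ?thesis
    using prime[of e "b * e"] nonzero by blast
qed

text \<open>Any nonzero \<open>b v\<close> generates \<open>v\<close> again: primeness gives
  \<open>y\<close> with \<open>e y b v\<close> nonzero, and \<open>v = e v\<close> turns this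
  element into \<open>\<tau> (y * b) *\<^sub>C v\<close>.\<close>

lemma minimal_left_ideal_range:
  assumes "e * v = v" "v \<noteq> 0"
  shows "minimal_left_ideal (range (\<lambda>b. b * v))"
  unfolding minimal_left_ideal_def
proof (intro conjI allI impI)
  show "left_ideal (range (\<lambda>b. b * v))"
    unfolding left_ideal_def complex_vector.subspace_def
    by (auto simp: image_iff distrib_right[symmetric] mult_scaleC_left[symmetric] mult.assoc[symmetric]
        intro: exI[of _ 0])
  show "range (\<lambda>b. b * v) \<noteq> {0}"
    using assms by (metis rangeI singletonD)
  fix J assume J: "left_ideal J \<and> J \<subseteq> range (\<lambda>b. b * v)"
  then have sub: "complex_vector.subspace J" and mult: "\<And>a x. x \<in> J \<Longrightarrow> a * x \<in> J"
    by (auto simp: left_ideal_def)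
  show "J = {0} \<or> J = range (\<lambda>b. b * v)"
  proof (cases "J \<subseteq> {0}")
    case True
    then show ?thesis
      using complex_vector.subspace_0[OF sub] by blast
  next
    case False
    then obtain b where b: "b * v \<in> J" "b * v \<noteq> 0"
      using J by blast
    obtain y where y: "e * y * (b * v) \<noteq> 0"
      using prime[of e "b * v"] nonzero b by blast
    have "e * y * (b * v) = \<tau> (y * b) *\<^sub>C v"
      using tau[of "y * b"] by (metis assms(1) mult.assoc mult_scaleC_left)
    with y mult[OF b(1), of "e * y"] have "\<tau> (y * b) *\<^sub>C v \<in> J" "\<tau> (y * b) \<noteq> 0"
      by auto
    then have "v \<in> J"
      using complex_vector.subspace_scale[OF sub, of _ "inverse (\<tau> (y * b))"]
      by (fastforce simp: scaleC_scaleC scaleC_one)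
    then show ?thesis
      using J mult by blast
  qed
qed

lemma mult_in_socle:
  assumes "e * v = v"
  shows "u * v \<in> socle"
proof (cases "v = 0")
  case True
  then show ?thesis
    by (simp add: socle_def complex_vector.span_zero)
next
  case False
  then show ?thesis
    unfolding socle_def using minimal_left_ideal_range[OF assms]
    by (intro complex_vector.span_base) auto
qed

end

section \<open>Derivations\<close>

lemma
  assumes "derivation d"
  shows derivation_add: "d (x + y) = d x + d y"
    and derivation_scale: "d (c *\<^sub>C x) = c *\<^sub>C d x"
    and derivation_mult: "d (x * y) = d x * y + x * d y"
proof -
  interpret Vector_Spaces.linear scaleC scaleC d
    using assms by (simp add: derivation_def)
  show "d (x + y) = d x + d y" "d (c *\<^sub>C x) = c *\<^sub>C d x"
    by (simp_all add: add scale)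
  show "d (x * y) = d x * y + x * d y"
    using assms by (simp add: derivation_def)
qed

lemma derivation_zero: "derivation d \<Longrightarrow> d 0 = 0"
  using derivation_add[of d 0 0] by simp

lemma derivationI:
  assumes "\<And>x y. d (x + y) = d x + d y" "\<And>c x. d (c *\<^sub>C x) = c *\<^sub>C d x"
    "\<And>x y. d (x * y) = d x * y + x * d y"
  shows "derivation d"
  unfolding derivation_def using assms
  by (auto intro!: Vector_Spaces.linear.intro module_hom.intro module_hom_axioms.intro
      complex_vector.vector_space_axioms complex_vector.module_axioms)

lemma spectrum_cubic:
  fixes b :: "'a::complex_banach_algebra_1"
  assumes "b * (b * b) = (s * s) *\<^sub>C b"
  shows "spectrum b \<subseteq> {0, s, - s}"
proof
  fix c assume c: "c \<in> spectrum b"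
  show "c \<in> {0, s, - s}"
  proof (rule ccontr)
    assume "c \<notin> {0, s, - s}"
    then have nz: "c * (c * c - s * s) \<noteq> 0"
      by (auto simp: square_eq_iff)
    \<comment> \<open>The quotient \<open>(p(c) - p(b)) / (c - b)\<close> for
      \<open>p(z) = z^3 - s^2 z\<close>. Since \<open>p(b) = 0\<close>, its product with
      \<open>c - b\<close> is the nonzero scalar \<open>p(c)\<close>.\<close>
    define q where "q = (c * c - s * s) *\<^sub>C 1 + c *\<^sub>C b + b * b"
    have "(c *\<^sub>C 1 - b) * q = (c * (c * c - s * s)) *\<^sub>C 1"
      "q * (c *\<^sub>C 1 - b) = (c * (c * c - s * s)) *\<^sub>C 1"
      by (simp_all add: q_def assms algebra_simps mult_scaleC_left mult_scaleC_right
          scaleC_scaleC scaleC_add_left scaleC_add_right complex_vector.scale_left_diff_distrib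
          complex_vector.scale_right_diff_distrib)
    moreover have "inverse (c * (c * c - s * s)) * (c * (c * c - s * s)) = 1"
      by (rule left_inverse[OF nz])
    ultimately have "invertible_elem (c *\<^sub>C 1 - b)"
      unfolding invertible_elem_def
      by (intro exI[of _ "inverse (c * (c * c - s * s)) *\<^sub>C q"])
        (simp only: mult_scaleC_left mult_scaleC_right scaleC_scaleC scaleC_one)
    with c show False
      by (simp add: spectrum_def)
  qed
qed

section \<open>Spectra of derivatives of square-zero elements \<open>u v\<close>\<close>

context minimal_idempotent
begin

lemma derivation_corner:
  assumes "derivation d" "u * e = u" "e * v = v" "v * u = 0"
  shows "v * d u = \<tau> (v * d u) *\<^sub>C e"
proof -
  have "v * d (u * e) = v * (d u * e) + v * u * d e"
    by (simp add: derivation_mult[OF assms(1)] distrib_left mult.assoc)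
  then have "v * d u = v * (d u * e) + v * u * d e"
    by (simp only: assms(2))
  also have "\<dots> = e * (v * d u) * e"
    by (simp add: assms(3,4) mult.assoc[symmetric])
  finally show ?thesis
    using tau by simp
qed

lemma derivation_corner':
  assumes "derivation d" "v * u = 0"
  shows "d v * u = - (v * d u)"
  using derivation_mult[OF assms(1), of v u] assms derivation_zero[OF assms(1)]
  by (simp add: eq_neg_iff_add_eq_0)

text \<open>Left multiplication by \<open>d(u v)\<close> maps the span of \<open>d(u) v\<close>,
  \<open>u v\<close> and \<open>u d(v)\<close> into itself, triangularly with diagonal
  \<open>s\<close>, \<open>- s\<close>, \<open>- s\<close>. The off-diagonal \<open>r\<close>
  cancels in the cube of \<open>d(u v)\<close>.\<close>

lemma spectrum_derivation:
  assumes d: "derivation d" and u: "u * e = u" and v: "e * v = v" and vu: "v * u = 0"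
  defines "s \<equiv> \<tau> (v * d u)"
  shows "spectrum (d (u * v)) \<subseteq> {0, s, - s}"
proof (rule spectrum_cubic)
  define r where "r = \<tau> (d v * d u)"
  let ?b = "d u * v + u * d v"
  have 1: "v * d u = s *\<^sub>C e" "d v * u = (- s) *\<^sub>C e"
    using derivation_corner[OF d u v vu] derivation_corner'[OF d vu] by (simp_all add: s_def)
  have 2: "u * (d v * d u) * v = r *\<^sub>C (u * v)"
  proof -
    have "u * (d v * d u) * v = u * (e * (d v * d u) * e) * v"
      by (metis u v mult.assoc)
    then show ?thesis
      by (simp add: tau r_def mult_scaleC_left mult_scaleC_right u)
  qed
  have "?b * (d u * v) = d u * (v * d u) * v + u * (d v * d u) * v"
    by (simp add: algebra_simps)
  then have 3: "?b * (d u * v) = s *\<^sub>C (d u * v) + r *\<^sub>C (u * v)"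
    unfolding 1 2 by (simp add: mult_scaleC_left mult_scaleC_right mult.assoc v)
  have "?b * (u * d v) = d u * (v * u) * d v + u * (d v * u) * d v"
    by (simp add: algebra_simps)
  then have 4: "?b * (u * d v) = (- s) *\<^sub>C (u * d v)"
    unfolding 1 vu by (simp add: mult_scaleC_left mult_scaleC_right u)
  have "?b * (u * v) = d u * (v * u) * v + u * (d v * u) * v"
    by (simp add: algebra_simps)
  then have 5: "?b * (u * v) = (- s) *\<^sub>C (u * v)"
    unfolding 1 vu by (simp add: mult_scaleC_left mult_scaleC_right u)
  have "?b * ?b = ?b * (d u * v) + ?b * (u * d v)"
    by (rule distrib_left)
  also have "\<dots> = s *\<^sub>C (d u * v) + r *\<^sub>C (u * v) + (- s) *\<^sub>C (u * d v)"
    unfolding 3 4 ..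
  finally have "?b * (?b * ?b) = ?b * (s *\<^sub>C (d u * v) + r *\<^sub>C (u * v) + (- s) *\<^sub>C (u * d v))"
    by simp
  also have "\<dots> = s *\<^sub>C (?b * (d u * v)) + r *\<^sub>C (?b * (u * v)) + (- s) *\<^sub>C (?b * (u * d v))"
    by (simp only: distrib_left mult_scaleC_right)
  also have "\<dots> = (s * s) *\<^sub>C ?b"
    unfolding 3 4 5 by (simp add: scaleC_add_right scaleC_scaleC mult.commute)
  finally show "d (u * v) * (d (u * v) * d (u * v)) = (s * s) *\<^sub>C d (u * v)"
    unfolding derivation_mult[OF d, of u v] .
qed

lemma eigenvalue_derivation:
  assumes d: "derivation d" and u: "u * e = u" and v: "e * v = v" and vu: "v * u = 0" and "u \<noteq> 0"
  shows "- \<tau> (v * d u) \<in> spectrum (d (u * v))"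
proof -
  let ?s = "\<tau> (v * d u)"
  have "d (u * v) * u = d u * (v * u) + u * (d v * u)"
    by (simp add: derivation_mult[OF d] algebra_simps)
  also have "\<dots> = (- ?s) *\<^sub>C u"
    using derivation_corner[OF d u v vu] derivation_corner'[OF d vu]
    by (metis vu mult_zero_right add_0 mult_minus_right mult_scaleC_right u complex_vector.scale_minus_left)
  finally have eq: "((- ?s) *\<^sub>C 1 - d (u * v)) * u = 0"
    by (simp add: left_diff_distrib mult_scaleC_left)
  have "\<not> invertible_elem ((- ?s) *\<^sub>C 1 - d (u * v))"
  proof
    assume "invertible_elem ((- ?s) *\<^sub>C 1 - d (u * v))"
    then obtain b where "b * ((- ?s) *\<^sub>C 1 - d (u * v)) = 1"
      unfolding invertible_elem_def by blast
    then have "u = b * (((- ?s) *\<^sub>C 1 - d (u * v)) * u)"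
      by (metis mult.assoc mult_1_left)
    then show False
      using \<open>u \<noteq> 0\<close> eq by simp
  qed
  then show ?thesis
    by (simp add: spectrum_def)
qed

text \<open>For \<open>g\<close> one known eigenvalue suffices, for \<open>d\<close> an upper bound
  on the whole spectrum is used; the symmetry of \<open>{0, s, - s}\<close> absorbs the
  sign.\<close>

lemma spectral_inclusion_values:
  assumes d: "derivation d" and g: "derivation g"
    and incl: "\<forall>x\<in>socle. spectrum (g x) \<subseteq> spectrum (d x) \<union> {0}"
    and u: "u * e = u" and v: "e * v = v" and vu: "v * u = 0"
  shows "\<tau> (v * g u) \<in> {0, \<tau> (v * d u), - \<tau> (v * d u)}"
proof (cases "u = 0")
  case True
  then show ?thesis
    using tau_scale[of 0 0] by (simp add: derivation_zero[OF g])
next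
  case False
  have "- \<tau> (v * g u) \<in> spectrum (d (u * v)) \<union> {0}"
    using eigenvalue_derivation[OF g u v vu False] incl mult_in_socle[OF v, of u] by blast
  then show ?thesis
    using spectrum_derivation[OF d u v vu] by (auto simp: minus_equation_iff)
qed

end

section \<open>Functions that are polynomial on lines\<close>

text \<open>A substitute for polynomial functions on a possibly infinite-dimensional space: only
  restrictions to lines are recorded, with all three arguments moving at once.\<close>

definition polynomial_on_lines :: "('a \<Rightarrow> 'a \<Rightarrow> 'a::complex_vector \<Rightarrow> complex) \<Rightarrow> bool" where
  "polynomial_on_lines F \<longleftrightarrow> (\<forall>u u' v v' w w'. \<exists>p. \<forall>t.
     F (u + t *\<^sub>C u') (v + t *\<^sub>C v') (w + t *\<^sub>C w') = poly p t)"

lemma polynomial_on_lines_mult: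
  assumes "polynomial_on_lines F" "polynomial_on_lines G"
  shows "polynomial_on_lines (\<lambda>u v w. F u v w * G u v w)"
  using assms unfolding polynomial_on_lines_def by (metis poly_mult)

lemma polynomial_on_lines_diff:
  assumes "polynomial_on_lines F" "polynomial_on_lines G"
  shows "polynomial_on_lines (\<lambda>u v w. F u v w - G u v w)"
  using assms unfolding polynomial_on_lines_def by (metis poly_diff)

text \<open>Along the line joining a point where \<open>F\<close> is nonzero to one where
  \<open>G\<close> is nonzero, both become nonzero polynomials in \<open>t\<close>, whose product
  cannot vanish.\<close>

lemma polynomial_on_lines_mult_eq_0:
  assumes "polynomial_on_lines F" "polynomial_on_lines G" "\<And>u v w. F u v w * G u v w = 0"
  shows "(\<forall>u v w. F u v w = 0) \<or> (\<forall>u v w. G u v w = 0)"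
proof (rule ccontr)
  assume "\<not> ?thesis"
  then obtain u v w u' v' w' where nz: "F u v w \<noteq> 0" "G u' v' w' \<noteq> 0"
    by blast
  obtain p where p: "\<And>t. F (u + t *\<^sub>C (u' - u)) (v + t *\<^sub>C (v' - v)) (w + t *\<^sub>C (w' - w)) = poly p t"
    using assms(1) unfolding polynomial_on_lines_def by metis
  obtain q where q: "\<And>t. G (u + t *\<^sub>C (u' - u)) (v + t *\<^sub>C (v' - v)) (w + t *\<^sub>C (w' - w)) = poly q t"
    using assms(2) unfolding polynomial_on_lines_def by metis
  have "poly p 0 \<noteq> 0" "poly q 1 \<noteq> 0"
    using p[of 0] q[of 1] nz by (simp_all add: scaleC_one)
  moreover have "poly (p * q) t = 0" for t
    using assms(3) by (simp add: p[symmetric] q[symmetric])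
  then have "p * q = 0"
    by (simp add: poly_all_0_iff_0[symmetric])
  ultimately show False
    by auto
qed

section \<open>The wedge of a derivation and the consequences of its vanishing\<close>

context minimal_idempotent
begin

lemma polynomial_on_lines_tau:
  assumes "\<And>x y. k (x + y) = k x + k y" "\<And>c x. k (c *\<^sub>C x) = c *\<^sub>C k x"
  shows "polynomial_on_lines (\<lambda>u v w. \<tau> (v * k u))" "polynomial_on_lines (\<lambda>u v w. \<tau> (w * k u))"
proof -
  have "\<tau> ((v + t *\<^sub>C v') * k (u + t *\<^sub>C u')) =
      poly [:\<tau> (v * k u), \<tau> (v * k u') + \<tau> (v' * k u), \<tau> (v' * k u'):] t" for t u u' v v'
    by (simp add: assms tau_add tau_scale mult_scaleC_left mult_scaleC_right distrib_left
        distrib_right scaleC_scaleC)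
  then show "polynomial_on_lines (\<lambda>u v w. \<tau> (v * k u))" "polynomial_on_lines (\<lambda>u v w. \<tau> (w * k u))"
    unfolding polynomial_on_lines_def by blast+
qed

(* wedge h vanishes identically iff every vector of the module Be is an eigenvector of x \<mapsto> h(x)e. *)
definition wedge :: "('a \<Rightarrow> 'a) \<Rightarrow> 'a \<Rightarrow> 'a \<Rightarrow> 'a \<Rightarrow> complex" where
  "wedge h u v w = \<tau> (v * u) * \<tau> (w * h (u * e)) - \<tau> (w * u) * \<tau> (v * h (u * e))"

lemma polynomial_on_lines_wedge:
  assumes "derivation h"
  shows "polynomial_on_lines (wedge h)"
  unfolding wedge_def
  by (intro polynomial_on_lines_diff polynomial_on_lines_mult polynomial_on_lines_tau)
    (simp_all add: derivation_add[OF assms] derivation_scale[OF assms] distrib_right mult_scaleC_left)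

text \<open>The factor left of \<open>h (u * e)\<close> lies in \<open>eB\<close> and annihilates
  \<open>u * e\<close>; so the constraints of the spectral computation are parametrised by
  unrestricted \<open>v\<close> and \<open>w\<close>.\<close>

lemma wedge_eq_tau:
  "wedge h u v w = \<tau> (e * (\<tau> (v * u) *\<^sub>C w - \<tau> (w * u) *\<^sub>C v) * h (u * e))"
  by (simp add: wedge_def mult.assoc)
    (simp add: left_diff_distrib tau_diff tau_scale mult_scaleC_left)

lemma wedge_eq_0_imp:
  assumes h: "derivation h" and wedge: "\<And>u v w. wedge h u v w = 0"
  shows "h = (\<lambda>x. 0)"
proof -
  have eigen: "\<exists>c. h (u * e) * e = c *\<^sub>C (u * e)" for u
  proof (cases "u * e = 0")
    case True
    then show ?thesis
      by (simp add: derivation_zero[OF h])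
  next
    case False
    then obtain v where v: "\<tau> (v * u) \<noteq> 0"
      using tau_nondegenerate by blast
    \<comment> \<open>With \<open>v\<close> fixed, \<open>\<tau> (w * ?b)\<close> is the wedge at
      \<open>w\<close>, so nondegeneracy applies to \<open>?b\<close>.\<close>
    let ?b = "\<tau> (v * u) *\<^sub>C h (u * e) - \<tau> (v * h (u * e)) *\<^sub>C u"
    have "?b * e = 0"
      by (rule tau_nondegenerate)
        (use wedge in \<open>simp add: wedge_def right_diff_distrib tau_diff tau_scale mult_scaleC_right mult.commute\<close>)
    then have "\<tau> (v * u) *\<^sub>C (h (u * e) * e) = \<tau> (v * h (u * e)) *\<^sub>C (u * e)"
      by (simp add: left_diff_distrib mult_scaleC_left)
    then have "inverse (\<tau> (v * u)) *\<^sub>C \<tau> (v * u) *\<^sub>C (h (u * e) * e) =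
        inverse (\<tau> (v * u)) *\<^sub>C \<tau> (v * h (u * e)) *\<^sub>C (u * e)"
      by simp
    then show ?thesis
      using v by (auto simp: scaleC_scaleC scaleC_one)
  qed
  \<comment> \<open>Multiplying \<open>h e = h e * e + e * h e\<close> by \<open>e\<close> on the
    right gives \<open>e * h e * e = 0\<close>, so the eigenvalue at \<open>e\<close> is
    zero.\<close>
  have he: "h e * e = 0"
  proof -
    obtain c where c: "h e * e = c *\<^sub>C e"
      using eigen[of e] idem by auto
    have "h e = h e * e + e * h e"
      using derivation_mult[OF h, of e e] idem by simp
    then have "h e * e = h e * (e * e) + e * (h e * e)"
      by (metis distrib_right mult.assoc)
    then show ?thesis
      unfolding c by (simp add: idem c mult_scaleC_right)
  qed
  \<comment> \<open>For \<open>u * e\<close> independent of \<open>e\<close>, comparison with the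
    eigenvalue at the sum \<open>u * e + e\<close> forces the eigenvalue at \<open>u * e\<close> to
    agree with the zero one at \<open>e\<close>.\<close>
  have zero: "h (u * e) * e = 0" for u
  proof (cases "\<exists>k. u * e = k *\<^sub>C e")
    case True
    then show ?thesis
      using he by (auto simp: derivation_scale[OF h] mult_scaleC_left)
  next
    case False
    obtain c where c: "h (u * e) * e = c *\<^sub>C (u * e)"
      using eigen by blast
    obtain c' where c': "h ((u + e) * e) * e = c' *\<^sub>C ((u + e) * e)"
      using eigen by blast
    have "h ((u + e) * e) * e = c *\<^sub>C (u * e)"
      by (simp add: distrib_right idem derivation_add[OF h] he c)
    with c' have "c *\<^sub>C (u * e) = c' *\<^sub>C (u * e) + c' *\<^sub>C e"
      by (simp add: distrib_right idem scaleC_add_right)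
    then have eq: "(c - c') *\<^sub>C (u * e) = c' *\<^sub>C e"
      by (simp add: complex_vector.scale_left_diff_distrib)
    have "c - c' = 0"
    proof (rule ccontr)
      assume "c - c' \<noteq> 0"
      then have "u * e = inverse (c - c') *\<^sub>C (c - c') *\<^sub>C (u * e)"
        by (simp add: scaleC_scaleC scaleC_one)
      then have "u * e = (inverse (c - c') * c') *\<^sub>C e"
        unfolding eq by (simp add: scaleC_scaleC)
      with False show False by blast
    qed
    with eq have "c = 0"
      using nonzero by simp
    with c show ?thesis by simp
  qed
  \<comment> \<open>Expanding \<open>h (a * (x * e)) * e = 0\<close> by the product rule leaves
    \<open>h a * x * e = 0\<close> for all \<open>x\<close>, where primeness applies.\<close>
  have "h a = 0" for a
  proof -
    have "h a * x * e = 0" for x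
    proof -
      have "h (a * (x * e)) * e = h a * (x * e) * e + a * (h (x * e) * e)"
        by (simp add: derivation_mult[OF h, of a] distrib_right mult.assoc)
      moreover have "h (a * (x * e)) * e = 0"
        using zero[of "a * x"] by (simp add: mult.assoc)
      ultimately show ?thesis
        by (simp add: zero mult.assoc idem)
    qed
    then show ?thesis
      using prime nonzero by blast
  qed
  then show ?thesis by blast
qed

end

theorem theorem3p1:
  fixes d g :: "'a::complex_banach_algebra_1 \<Rightarrow> 'a"
  assumes "primitive_algebra TYPE('a)"
    and "has_nonzero_socle TYPE('a)"
    and "derivation d" and "derivation g"
    and "\<forall>x\<in>socle. spectrum (g x) \<subseteq> spectrum (d x) \<union> {0}"
  shows "\<exists>c\<in>{-1, 0, 1 :: complex}. g = (\<lambda>x. c *\<^sub>C d x)"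
proof -
  obtain e :: 'a where "minimal_idempotent e"
    using minimal_idempotent_exists[OF assms(1,2)] by blast
  then interpret minimal_idempotent e .
  note d = assms(3) and g = assms(4)
  let ?m = "\<lambda>x. g x - d x" and ?p = "\<lambda>x. g x + d x"
  have m: "derivation ?m" and p: "derivation ?p"
    by (rule derivationI; simp add: derivation_add[OF d] derivation_add[OF g] derivation_scale[OF d]
        derivation_scale[OF g] derivation_mult[OF d] derivation_mult[OF g] algebra_simps
        scaleC_add_right complex_vector.scale_right_diff_distrib)+
  \<comment> \<open>With \<open>s = \<tau> (?v * d (u * e))\<close>, the admissible values
    \<open>0\<close>, \<open>s\<close>, \<open>- s\<close> of \<open>\<tau> (?v * g (u * e))\<close>
    make the wedge of \<open>g\<close>, \<open>?m\<close>, \<open>?p\<close> vanish,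
    respectively.\<close>
  have "wedge g u v w * (wedge ?m u v w * wedge ?p u v w) = 0" for u v w
  proof -
    let ?v = "e * (\<tau> (v * u) *\<^sub>C w - \<tau> (w * u) *\<^sub>C v)"
    have "?v * (u * e) = e * (?v * u) * e"
      by (simp add: mult.assoc[symmetric] idem)
    also have "\<dots> = \<tau> (?v * u) *\<^sub>C e"
      by (rule tau)
    also have "\<tau> (?v * u) = 0"
      by (simp add: mult.assoc) (simp add: left_diff_distrib mult_scaleC_left tau_diff tau_scale)
    finally have "\<tau> (?v * g (u * e)) \<in> {0, \<tau> (?v * d (u * e)), - \<tau> (?v * d (u * e))}"
      by (intro spectral_inclusion_values[OF d g assms(5)])
        (simp_all add: mult.assoc idem, simp_all add: mult.assoc[symmetric] idem)
    then show ?thesis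
      unfolding wedge_eq_tau by (auto simp: distrib_left right_diff_distrib tau_add tau_diff)
  qed
  from polynomial_on_lines_mult_eq_0[OF polynomial_on_lines_wedge[OF g]
      polynomial_on_lines_mult[OF polynomial_on_lines_wedge[OF m] polynomial_on_lines_wedge[OF p]] this]
  consider "\<forall>u v w. wedge g u v w = 0" | "\<forall>u v w. wedge ?m u v w * wedge ?p u v w = 0"
    by blast
  then have "g = (\<lambda>x. 0) \<or> ?m = (\<lambda>x. 0) \<or> ?p = (\<lambda>x. 0)"
  proof cases
    case 1
    then show ?thesis
      using wedge_eq_0_imp[OF g] by blast
  next
    case 2
    then show ?thesis
      using polynomial_on_lines_mult_eq_0[OF polynomial_on_lines_wedge[OF m] polynomial_on_lines_wedge[OF p]]
        wedge_eq_0_imp[OF m] wedge_eq_0_imp[OF p] by blast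
  qed
  then show ?thesis
    by (auto simp: fun_eq_iff scaleC_one eq_neg_iff_add_eq_0)
qed

end
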